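(* Let $n$ be an odd positive integer and let $C = vC_1\oplus(1-v)C_2$ be a cyclic code of length $n$ over $R=\mathbb{Z}_4+v\mathbb{Z}_4$, $v^2=v$, where $C_1,C_2$ are the corresponding cyclic codes of length $n$ over $\mathbb{Z}_4$. For $i=1,2$ let $p_i(x),q_i(x),r_i(x)\in\mathbb{Z}_4[x]$ be the monic polynomials such that $p_i(x)q_i(x)r_i(x)=x^n-1$ and $C_i=\langle p_i(x)q_i(x),\,2p_i(x)\rangle$ in $\mathbb{Z}_4[x]/\langle x^n-1\rangle$. Then, as an ideal of $R[x]/\langle x^n-1\rangle$, $$C=\langle v\,p_1(x)q_1(x),\; 2v\,p_1(x),\; (1-v)\,p_2(x)q_2(x),\; 2(1-v)\,p_2(x)\rangle .$$
   Context: $R=\mathbb{Z}_4[v]/\langle v^2-v\rangle=\mathbb{Z}_4+v\mathbb{Z}_4$. A linear code of length $n$ over a commutative ring $A$ is an $A$-submodule of $A^n$; it is cyclic if it is closed under the cyclic shift, equivalently, under $(c_0,\dots,c_{n-1})\leftrightarrow c_0+c_1x+\dots+c_{n-1}x^{n-1}$, it is an ideal of $A[x]/\langle x^n-1\rangle$. Since $v$ and $1-v$ are orthogonal idempotents with sum $1$, every linear code $C$ over $R$ is uniquely of the form $C=vC_1\oplus(1-v)C_2=\{vc_1+(1-v)c_2: c_1\in C_1, c_2\in C_2\}$ with $C_1,C_2$ linear codes over $\mathbb{Z}_4$, and $C$ is cyclic iff $C_1$ and $C_2$ are cyclic. For odd $n$, every cyclic code $D$ of length $n$ over $\mathbb{Z}_4$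 equals $\langle f(x)g(x),2f(x)\rangle$ for unique monic polynomials $f,g,h\in\mathbb{Z}_4[x]$ with $f(x)g(x)h(x)=x^n-1$. *)

theory Defs
  imports
    "Jordan_Normal_Form.Matrix"
    "HOL-Algebra.QuotRing"
    "HOL-Computational_Algebra.Polynomial"
    "HOL-Library.Numeral_Type"
begin

section \<open>The ring R = Z4[v] / (v^2 - v)\<close>

text \<open>
  The type \<open>4\<close> of \<open>HOL-Library.Numeral_Type\<close> is the ring of integers modulo 4, and the variable
  of \<open>4 poly\<close> plays the role of \<open>v\<close> here; \<open>[:0, -1, 1:]\<close> is the polynomial \<open>v^2 - v\<close>.
\<close>

type_synonym z4 = "4"

definition z4v_rel :: "z4 poly \<Rightarrow> z4 poly \<Rightarrow> bool" where
  "z4v_rel p q \<longleftrightarrow> [:0, -1, 1:] dvd p - q"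

lemma equivp_z4v_rel: "equivp z4v_rel"
proof (rule equivpI)
  show "reflp z4v_rel"
    by (simp add: reflp_def z4v_rel_def)
  show "symp z4v_rel"
  proof (rule sympI)
    fix p q :: "z4 poly"
    assume "z4v_rel p q"
    then have "[:0, -1, 1:] dvd - (p - q)"
      unfolding z4v_rel_def by (simp only: dvd_minus_iff)
    then show "z4v_rel q p"
      unfolding z4v_rel_def by (simp only: minus_diff_eq)
  qed
  show "transp z4v_rel"
  proof (rule transpI)
    fix p q r :: "z4 poly"
    assume "z4v_rel p q" "z4v_rel q r"
    then have "[:0, -1, 1:] dvd (p - q) + (q - r)"
      unfolding z4v_rel_def by (rule dvd_add)
    then show "z4v_rel p r"
      unfolding z4v_rel_def by simp
  qed
qed

lemma z4v_rel_eqI: "p = q \<Longrightarrow> z4v_rel p q"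
  by (simp add: z4v_rel_def)

quotient_type z4v = "z4 poly" / z4v_rel
  by (rule equivp_z4v_rel)

instantiation z4v :: comm_ring_1
begin

lift_definition zero_z4v :: z4v is 0 .

lift_definition one_z4v :: z4v is 1 .

lift_definition plus_z4v :: "z4v \<Rightarrow> z4v \<Rightarrow> z4v" is "(+)"
  unfolding z4v_rel_def by (simp only: add_diff_add dvd_add)

lift_definition uminus_z4v :: "z4v \<Rightarrow> z4v" is uminus
  unfolding z4v_rel_def by (simp only: minus_diff_minus dvd_minus_iff)

lift_definition minus_z4v :: "z4v \<Rightarrow> z4v \<Rightarrow> z4v" is "(-)"
proof -
  fix p p' q q' :: "z4 poly"
  assume "z4v_rel p p'" "z4v_rel q q'"
  moreover have "p - q - (p' - q') = (p - p') - (q - q')"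
    by (simp only: algebra_simps)
  ultimately show "z4v_rel (p - q) (p' - q')"
    unfolding z4v_rel_def by (simp only: dvd_diff)
qed

lift_definition times_z4v :: "z4v \<Rightarrow> z4v \<Rightarrow> z4v" is "(*)"
proof -
  fix p p' q q' :: "z4 poly"
  assume "z4v_rel p p'" "z4v_rel q q'"
  moreover have "p * q - p' * q' = (p - p') * q + p' * (q - q')"
    by (simp add: algebra_simps)
  ultimately show "z4v_rel (p * q) (p' * q')"
    unfolding z4v_rel_def by (simp only: dvd_add dvd_mult dvd_mult2)
qed

instance
proof
  show "(0::z4v) \<noteq> 1"
  proof (transfer, unfold z4v_rel_def, rule notI)
    assume "[:0, -1, 1:] dvd (0 - 1 :: z4 poly)"
    then obtain k :: "z4 poly" where "0 - 1 = [:0, -1, 1:] * k" ..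
    then have "poly (0 - 1) 0 = poly ([:0, -1, 1:] * k) 0"
      by (rule arg_cong)
    then show False
      by simp
  qed
qed (transfer, rule z4v_rel_eqI, simp add: algebra_simps)+

end

lift_definition vR :: z4v is "[:0, 1:]" .

lift_definition of_z4 :: "z4 \<Rightarrow> z4v" is "\<lambda>a. [:a:]" .

lemma vR_idem: "vR\<^sup>2 = vR"
  unfolding power2_eq_square by transfer (simp add: z4v_rel_def)

lemma of_z4_simps [simp]:
  "of_z4 0 = 0" "of_z4 1 = 1"
  "of_z4 (a + b) = of_z4 a + of_z4 b" "of_z4 (a * b) = of_z4 a * of_z4 b"
  by (transfer, rule z4v_rel_eqI, simp add: one_pCons)+

lemma z4v_repr: "\<exists>!ab. x = of_z4 (fst ab) + of_z4 (snd ab) * vR"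
proof -
  have ex: "\<exists>a b. x = of_z4 a + of_z4 b * vR"
  proof (transfer)
    fix p :: "z4 poly"
    show "\<exists>a b. z4v_rel p ([:a:] + [:b:] * [:0, 1:])"
    proof (induction p)
      case 0
      have "z4v_rel 0 ([:0:] + [:0:] * [:0, 1:])"
        by (simp add: z4v_rel_def)
      then show ?case by blast
    next
      case (pCons c p)
      then obtain a b where "[:0, -1, 1:] dvd p - ([:a:] + [:b:] * [:0, 1:])"
        by (auto simp: z4v_rel_def)
      then have "[:0, -1, 1:] dvd [:0, 1:] * (p - [:a, b:]) + [:b:] * [:0, -1, 1:]"
        by (intro dvd_add dvd_mult) simp_all
      also have "[:0, 1:] * (p - [:a, b:]) + [:b:] * [:0, -1, 1:]
          = pCons c p - ([:c:] + [:a + b:] * [:0, 1:])"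
        by (simp add: algebra_simps)
      finally show ?case
        unfolding z4v_rel_def by blast
    qed
  qed
  moreover have "a = a' \<and> b = b'"
    if "of_z4 a + of_z4 b * vR = of_z4 a' + of_z4 b' * vR" for a b a' b'
  proof -
    have "z4v_rel ([:a:] + [:b:] * [:0, 1:]) ([:a':] + [:b':] * [:0, 1:])"
      using that by (simp only: of_z4.abs_eq vR.abs_eq times_z4v.abs_eq plus_z4v.abs_eq
          z4v.abs_eq_iff)
    then have "[:0, -1, 1:] dvd [:a - a', b - b':]"
      by (simp add: z4v_rel_def)
    then obtain k where k: "[:a - a', b - b':] = [:0, -1, 1:] * k" ..
    have "a - a' = 0"
      using arg_cong[OF k, of "\<lambda>p. poly p 0"] by simp
    moreover have "a - a' + (b - b') = 0"
      using arg_cong[OF k, of "\<lambda>p. poly p 1"] by simp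
    ultimately have "a - a' = 0 \<and> b - b' = 0"
      by (simp only: add_0_left)
    then show ?thesis
      by (simp only: right_minus_eq)
  qed
  ultimately show ?thesis
    by (metis prod.collapse fst_conv snd_conv)
qed


section \<open>Linear and cyclic codes\<close>

definition type_ring :: "'a :: comm_ring_1 ring" where
  "type_ring = \<lparr>carrier = UNIV, mult = (*), one = 1, zero = 0, add = (+)\<rparr>"

lemma cring_type_ring: "cring (type_ring :: 'a :: comm_ring_1 ring)"
proof (rule cringI)
  show "abelian_group (type_ring :: 'a ring)"
  proof (rule abelian_groupI)
    fix x :: 'a
    show "\<exists>y\<in>carrier type_ring. y \<oplus>\<^bsub>type_ring\<^esub> x = \<zero>\<^bsub>type_ring\<^esub>"
      by (auto simp: type_ring_def intro: exI[of _ "- x"])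
  qed (auto simp: type_ring_def algebra_simps)
  show "comm_monoid (type_ring :: 'a ring)"
    by (rule comm_monoidI) (auto simp: type_ring_def algebra_simps)
qed (auto simp: type_ring_def algebra_simps)

definition linear_code :: "nat \<Rightarrow> 'a :: comm_ring_1 vec set \<Rightarrow> bool" where
  "linear_code n C \<longleftrightarrow> submodule C type_ring (module_vec TYPE('a) n)"

text \<open>\<open>(c\<^sub>0, \<dots>, c\<^sub>n\<^sub>-\<^sub>1) \<mapsto> (c\<^sub>n\<^sub>-\<^sub>1, c\<^sub>0, \<dots>, c\<^sub>n\<^sub>-\<^sub>2)\<close>\<close>

definition cyclic_shift :: "'a vec \<Rightarrow> 'a vec" where
  "cyclic_shift c = vec (dim_vec c) (\<lambda>i. c $ ((i + dim_vec c - 1) mod dim_vec c))"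

definition cyclic_code :: "nat \<Rightarrow> 'a :: comm_ring_1 vec set \<Rightarrow> bool" where
  "cyclic_code n C \<longleftrightarrow> linear_code n C \<and> (\<forall>c\<in>C. cyclic_shift c \<in> C)"

text \<open>The code \<open>v C\<^sub>1 \<oplus> (1 - v) C\<^sub>2\<close> over R determined by codes over Z4:\<close>

definition code_sum :: "z4 vec set \<Rightarrow> z4 vec set \<Rightarrow> z4v vec set" where
  "code_sum C1 C2 =
     {vR \<cdot>\<^sub>v map_vec of_z4 c1 + (1 - vR) \<cdot>\<^sub>v map_vec of_z4 c2 | c1 c2. c1 \<in> C1 \<and> c2 \<in> C2}"


section \<open>The ring A[x] / (x^n - 1)\<close>

definition xn1_ideal :: "nat \<Rightarrow> 'a :: comm_ring_1 poly set" where
  "xn1_ideal n = PIdl\<^bsub>type_ring\<^esub> (monom 1 n - 1)"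

definition xn1_ring :: "nat \<Rightarrow> 'a :: comm_ring_1 poly set ring" where
  "xn1_ring n = type_ring Quot xn1_ideal n"

lemma cring_xn1_ring: "cring (xn1_ring n :: 'a :: comm_ring_1 poly set ring)"
proof -
  interpret cring "type_ring :: 'a poly ring"
    by (rule cring_type_ring)
  have "ideal (xn1_ideal n) (type_ring :: 'a poly ring)"
    unfolding xn1_ideal_def by (rule cgenideal_ideal) (simp add: type_ring_def)
  then show ?thesis
    unfolding xn1_ring_def by (rule ideal.quotient_is_cring) (rule is_cring)
qed

definition xn1_class :: "nat \<Rightarrow> 'a :: comm_ring_1 poly \<Rightarrow> 'a poly set" where
  "xn1_class n p = xn1_ideal n +>\<^bsub>type_ring\<^esub> p"

definition word_poly :: "'a :: comm_ring_1 vec \<Rightarrow> 'a poly" where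
  "word_poly c = (\<Sum>i<dim_vec c. monom (c $ i) i)"

text \<open>A code of length \<open>n\<close> over \<open>A\<close>, viewed as a subset of \<open>A[x] / (x^n - 1)\<close>:\<close>

definition code_ideal :: "nat \<Rightarrow> 'a :: comm_ring_1 vec set \<Rightarrow> 'a poly set set" where
  "code_ideal n C = (\<lambda>c. xn1_class n (word_poly c)) ` C"

end

theory Submission
  imports Defs "Jordan_Normal_Form.Char_Poly"
begin

text \<open>
  Since \<open>v\<close> and \<open>1 - v\<close> are orthogonal idempotents with sum \<open>1\<close>, the map
  \<open>(a, b) \<mapsto> v a + (1 - v) b\<close> is a ring isomorphism from \<open>Z4[x] \<times> Z4[x]\<close> onto \<open>R[x]\<close>. An ideal
  generated by elements of the form \<open>v a\<close> and \<open>(1 - v) b\<close> is therefore the image of the product of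
  the ideals generated by the \<open>a\<close>'s and the \<open>b\<close>'s, and the map sends the pair \<open>(x^n - 1, x^n - 1)\<close>
  to \<open>x^n - 1\<close>, so all this descends to the quotients modulo \<open>x^n - 1\<close>.
\<close>

section \<open>Generated ideals under surjective ring homomorphisms\<close>

lemma (in ring_hom_ring) genideal_image_surj:
  assumes surj: "h ` carrier R = carrier S" and X: "X \<subseteq> carrier R"
  shows "Idl\<^bsub>S\<^esub> (h ` X) = h ` (Idl\<^bsub>R\<^esub> X)"
proof
  have hX: "h ` X \<subseteq> carrier S"
    using X surj by blast
  interpret I: ideal "Idl\<^bsub>R\<^esub> X" R
    using X by (rule R.genideal_ideal)
  \<comment> \<open>Surjectivity makes the image absorb multiplication by all of \<open>S\<close>:
    every multiplier is some \<open>h y\<close>.\<close>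
  have "ideal (h ` (Idl\<^bsub>R\<^esub> X)) S"
  proof (rule idealI)
    show "subgroup (h ` (Idl\<^bsub>R\<^esub> X)) (add_monoid S)"
      by (rule img_is_add_subgroup) (rule I.a_subgroup)
  next
    fix a x assume "a \<in> h ` (Idl\<^bsub>R\<^esub> X)" "x \<in> carrier S"
    then obtain b y where "b \<in> Idl\<^bsub>R\<^esub> X" "a = h b" "y \<in> carrier R" "x = h y"
      using surj by blast
    then show "x \<otimes>\<^bsub>S\<^esub> a \<in> h ` (Idl\<^bsub>R\<^esub> X)" "a \<otimes>\<^bsub>S\<^esub> x \<in> h ` (Idl\<^bsub>R\<^esub> X)"
      by (auto simp flip: hom_mult simp: I.Icarr I.I_l_closed I.I_r_closed)
  qed (rule S.ring_axioms)
  then show "Idl\<^bsub>S\<^esub> (h ` X) \<subseteq> h ` (Idl\<^bsub>R\<^esub> X)"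
    using R.genideal_self[OF X] by (intro S.genideal_minimal) auto
  have "ideal {r \<in> carrier R. h r \<in> Idl\<^bsub>S\<^esub> (h ` X)} R"
    using S.genideal_ideal[OF hX] by (rule ideal_vimage)
  then have "Idl\<^bsub>R\<^esub> X \<subseteq> {r \<in> carrier R. h r \<in> Idl\<^bsub>S\<^esub> (h ` X)}"
    using X S.genideal_self[OF hX] by (intro R.genideal_minimal) auto
  then show "h ` (Idl\<^bsub>R\<^esub> X) \<subseteq> Idl\<^bsub>S\<^esub> (h ` X)"
    by blast
qed

section \<open>Ideals of polynomial rings and the quotient modulo \<open>x^n - 1\<close>\<close>

lemma type_ring_simps [simp]:
  "carrier type_ring = UNIV" "x \<otimes>\<^bsub>type_ring\<^esub> y = x * y" "x \<oplus>\<^bsub>type_ring\<^esub> y = x + y"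
  "\<zero>\<^bsub>type_ring\<^esub> = 0" "\<one>\<^bsub>type_ring\<^esub> = 1"
  by (simp_all add: type_ring_def)

lemma ring_type_ring: "ring (type_ring :: 'a :: comm_ring_1 ring)"
  by (rule cring.axioms(1)) (rule cring_type_ring)

lemma a_inv_type_ring: "\<ominus>\<^bsub>type_ring\<^esub> x = - (x :: 'a :: comm_ring_1)"
proof -
  interpret ring "type_ring :: 'a ring"
    by (rule ring_type_ring)
  show ?thesis
    by (rule minus_equality) simp_all
qed

text \<open>Additive inverses come from multiplying by \<open>- 1\<close>, and commutativity turns
  left absorption into two-sided absorption.\<close>

lemma ideal_type_ring_iff:
  fixes I :: "'a :: comm_ring_1 set"
  shows "ideal I type_ring \<longleftrightarrow>
    0 \<in> I \<and> (\<forall>x\<in>I. \<forall>y\<in>I. x + y \<in> I) \<and> (\<forall>x\<in>I. \<forall>r. r * x \<in> I)"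
proof (intro iffI conjI ballI allI; (elim conjE)?)
  assume "ideal I type_ring"
  then interpret ideal I type_ring .
  show "0 \<in> I"
    using additive_subgroup.zero_closed[OF is_additive_subgroup] by simp
  show "x + y \<in> I" if "x \<in> I" "y \<in> I" for x y
    using additive_subgroup.a_closed[OF is_additive_subgroup that] by simp
  show "r * x \<in> I" if "x \<in> I" for x r
    using I_l_closed[OF that] by simp
next
  interpret ring "type_ring :: 'a ring"
    by (rule ring_type_ring)
  assume zero: "0 \<in> I" and add: "\<forall>x\<in>I. \<forall>y\<in>I. x + y \<in> I" and mult: "\<forall>x\<in>I. \<forall>r. r * x \<in> I"
  show "ideal I type_ring"
  proof (rule idealI)
    show "subgroup I (add_monoid type_ring)"
    proof (rule add.subgroupI)
      show "\<ominus>\<^bsub>type_ring\<^esub> x \<in> I" if "x \<in> I" for x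
      proof -
        have "- 1 * x \<in> I"
          using mult that by blast
        then show ?thesis
          by (simp add: a_inv_type_ring)
      qed
    qed (use zero add in auto)
  qed (use mult in \<open>auto simp: mult.commute ring_type_ring\<close>)
qed

lemma ideal_xn1_ideal: "ideal (xn1_ideal n) (type_ring :: 'a :: comm_ring_1 poly ring)"
  unfolding xn1_ideal_def by (rule cring.cgenideal_ideal[OF cring_type_ring]) simp

lemma ring_hom_ring_xn1_class:
  "ring_hom_ring type_ring (xn1_ring n) (xn1_class n :: 'a :: comm_ring_1 poly \<Rightarrow> _)"
  using ideal.rcos_ring_hom_ring[OF ideal_xn1_ideal[of n, where ?'a = 'a]]
  by (simp add: xn1_ring_def xn1_class_def[abs_def])

text \<open>Turns equality of cosets into divisibility, so that a change of representative becomes a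
  computation with polynomials.\<close>

lemma xn1_class_eq_iff:
  fixes p q :: "'a :: comm_ring_1 poly"
  shows "xn1_class n p = xn1_class n q \<longleftrightarrow> monom 1 n - 1 dvd p - q"
proof -
  interpret ring "type_ring :: 'a poly ring"
    by (rule ring_type_ring)
  have "xn1_class n p = xn1_class n q \<longleftrightarrow> p - q \<in> xn1_ideal n"
    using quotient_eq_iff_same_a_r_cos[OF ideal_xn1_ideal, of p q n]
    by (simp add: xn1_class_def a_minus_def a_inv_type_ring)
  then show ?thesis
    by (auto simp: xn1_ideal_def cgenideal_def dvd_def mult.commute)
qed

lemma xn1_class_surj: "xn1_class n ` UNIV = carrier (xn1_ring n)"
  by (auto simp: xn1_class_def xn1_ring_def FactRing_def A_RCOSETS_def')

text \<open>The projection is surjective, so generated ideals can be computed among polynomials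
  first and projected afterwards, over Z4 and over R alike.\<close>

lemma genideal_xn1_class:
  fixes X :: "'a :: comm_ring_1 poly set"
  shows "Idl\<^bsub>xn1_ring n\<^esub> (xn1_class n ` X) = xn1_class n ` (Idl\<^bsub>type_ring\<^esub> X)"
  using ring_hom_ring.genideal_image_surj[OF ring_hom_ring_xn1_class, of n X]
  by (simp add: xn1_class_surj)

section \<open>Splitting R[x] into two copies of Z4[x]\<close>

interpretation of_z4: comm_ring_hom of_z4
  by unfold_locales simp_all

interpretation map_of_z4: map_poly_comm_ring_hom of_z4 ..

text \<open>The inverse of the Chinese remainder map: \<open>a\<close> is the value at
  \<open>v = 1\<close>, \<open>b\<close> the value at \<open>v = 0\<close>.\<close>

definition z4v_poly :: "z4 poly \<Rightarrow> z4 poly \<Rightarrow> z4v poly" where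
  "z4v_poly a b = smult vR (map_poly of_z4 a) + smult (1 - vR) (map_poly of_z4 b)"

lemma vR_mult_vR: "vR * vR = vR"
  using vR_idem by (simp add: power2_eq_square)

lemma z4v_poly_add: "z4v_poly a b + z4v_poly c d = z4v_poly (a + c) (b + d)"
  by (simp add: z4v_poly_def hom_distribs smult_add_right algebra_simps)

text \<open>The cross terms vanish because \<open>v (1 - v) = 0\<close>, and \<open>v\<close> and
  \<open>1 - v\<close> are their own squares.\<close>

lemma z4v_poly_mult: "z4v_poly a b * z4v_poly c d = z4v_poly (a * c) (b * d)"
  by (simp add: z4v_poly_def hom_distribs algebra_simps vR_mult_vR)

lemma z4v_poly_diff: "z4v_poly a b - z4v_poly c d = z4v_poly (a - c) (b - d)"
  by (simp add: z4v_poly_def hom_distribs algebra_simps smult_diff_right)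

lemma z4v_poly_diag: "z4v_poly a a = map_poly of_z4 a"
  by (simp add: z4v_poly_def flip: smult_add_left)

lemma z4v_poly_surj: "\<exists>a b. w = z4v_poly a b"
proof -
  \<comment> \<open>First split along the basis \<open>1, v\<close>, one coefficient at a
    time.\<close>
  have "\<exists>a b. w = map_poly of_z4 a + smult vR (map_poly of_z4 b)"
  proof (induction w)
    case 0
    show ?case
      by (intro exI[of _ 0]) simp
  next
    case (pCons c w)
    then obtain a b where "w = map_poly of_z4 a + smult vR (map_poly of_z4 b)"
      by blast
    moreover obtain s t where "c = of_z4 s + of_z4 t * vR"
      using z4v_repr[of c] by blast
    ultimately have
      "pCons c w = map_poly of_z4 (pCons s a) + smult vR (map_poly of_z4 (pCons t b))"
      by (simp add: of_z4.map_poly_pCons_hom mult.commute)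
    then show ?case
      by blast
  qed
  then obtain a b where "w = map_poly of_z4 a + smult vR (map_poly of_z4 b)"
    by blast
  \<comment> \<open>Change of basis: \<open>a + v b = v (a + b) + (1 - v) a\<close>.\<close>
  then have "w = z4v_poly (a + b) a"
    by (simp add: z4v_poly_def hom_distribs smult_add_right smult_diff_left)
  then show ?thesis
    by blast
qed

text \<open>Multiplying by the idempotents \<open>(1, 0)\<close> and \<open>(0, 1)\<close> separates
  components, so ideals of a product ring are products of ideals. Generators living in a single
  component therefore generate the product of the two component ideals.\<close>

lemma genideal_z4v_poly:
  "Idl\<^bsub>type_ring\<^esub> ((\<lambda>a. z4v_poly a 0) ` X \<union> z4v_poly 0 ` Y) =
    {z4v_poly a b | a b. a \<in> Idl\<^bsub>type_ring\<^esub> X \<and> b \<in> Idl\<^bsub>type_ring\<^esub> Y}"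
    (is "Idl\<^bsub>type_ring\<^esub> ?G = ?J")
proof
  interpret Z: ring "type_ring :: z4 poly ring"
    by (rule ring_type_ring)
  interpret R: ring "type_ring :: z4v poly ring"
    by (rule ring_type_ring)
  have X: "ideal (Idl\<^bsub>type_ring\<^esub> X) type_ring" "X \<subseteq> Idl\<^bsub>type_ring\<^esub> X"
    and Y: "ideal (Idl\<^bsub>type_ring\<^esub> Y) type_ring" "Y \<subseteq> Idl\<^bsub>type_ring\<^esub> Y"
    and G: "ideal (Idl\<^bsub>type_ring\<^esub> ?G) type_ring" "?G \<subseteq> Idl\<^bsub>type_ring\<^esub> ?G"
    using Z.genideal_ideal[of X] Z.genideal_ideal[of Y] R.genideal_ideal[of ?G]
      Z.genideal_self[of X] Z.genideal_self[of Y] R.genideal_self[of ?G] by simp_all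
  note X' = X(1)[unfolded ideal_type_ring_iff] and Y' = Y(1)[unfolded ideal_type_ring_iff]
    and G' = G(1)[unfolded ideal_type_ring_iff]
  have z: "z4v_poly 0 0 = 0"
    by (simp add: z4v_poly_def)
  have "ideal ?J type_ring"
    unfolding ideal_type_ring_iff
  proof (intro conjI ballI allI)
    show "0 \<in> ?J"
      using X' Y' z by force
    show "x + y \<in> ?J" if x: "x \<in> ?J" and y: "y \<in> ?J" for x y
    proof -
      from x obtain a b where x: "x = z4v_poly a b"
        and ab: "a \<in> Idl\<^bsub>type_ring\<^esub> X" "b \<in> Idl\<^bsub>type_ring\<^esub> Y"
        by blast
      from y obtain c d where y: "y = z4v_poly c d"
        and cd: "c \<in> Idl\<^bsub>type_ring\<^esub> X" "d \<in> Idl\<^bsub>type_ring\<^esub> Y"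
        by blast
      show ?thesis
        unfolding x y z4v_poly_add using ab cd X' Y' by blast
    qed
    show "r * x \<in> ?J" if x: "x \<in> ?J" for x r
    proof -
      from x obtain a b where x: "x = z4v_poly a b"
        and ab: "a \<in> Idl\<^bsub>type_ring\<^esub> X" "b \<in> Idl\<^bsub>type_ring\<^esub> Y"
        by blast
      \<comment> \<open>Absorption has to hold for every multiplier in R[x]; surjectivity reduces it
        to componentwise multiplication.\<close>
      obtain c d where r: "r = z4v_poly c d"
        using z4v_poly_surj by blast
      show ?thesis
        unfolding x r z4v_poly_mult using ab X' Y' by blast
    qed
  qed
  moreover have "?G \<subseteq> ?J"
    using X(2) Y(2) X' Y' by blast
  ultimately show "Idl\<^bsub>type_ring\<^esub> ?G \<subseteq> ?J"
    by (rule R.genideal_minimal)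
  have mult: "z4v_poly (r * a) 0 = z4v_poly r 0 * z4v_poly a 0"
    "z4v_poly 0 (r * a) = z4v_poly 0 r * z4v_poly 0 a" for r a
    by (simp_all add: z4v_poly_mult)
  have add: "z4v_poly (a + b) 0 = z4v_poly a 0 + z4v_poly b 0"
    "z4v_poly 0 (a + b) = z4v_poly 0 a + z4v_poly 0 b" for a b
    by (simp_all add: z4v_poly_add)
  \<comment> \<open>Minimality is applied in Z4[x], one component at a time: the polynomials that
    land in the generated ideal when placed in one component form an ideal, by \<open>mult\<close>
    and \<open>add\<close>.\<close>
  have "ideal {a. z4v_poly a 0 \<in> Idl\<^bsub>type_ring\<^esub> ?G} type_ring"
    using G' unfolding ideal_type_ring_iff by (simp add: mult add z)
  then have "Idl\<^bsub>type_ring\<^esub> X \<subseteq> {a. z4v_poly a 0 \<in> Idl\<^bsub>type_ring\<^esub> ?G}"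
    by (rule Z.genideal_minimal) (use G(2) in blast)
  moreover have "ideal {b. z4v_poly 0 b \<in> Idl\<^bsub>type_ring\<^esub> ?G} type_ring"
    using G' unfolding ideal_type_ring_iff by (simp add: mult add z)
  then have "Idl\<^bsub>type_ring\<^esub> Y \<subseteq> {b. z4v_poly 0 b \<in> Idl\<^bsub>type_ring\<^esub> ?G}"
    by (rule Z.genideal_minimal) (use G(2) in blast)
  \<comment> \<open>Adding the two components recovers an arbitrary element of
    \<open>?J\<close>.\<close>
  moreover have "z4v_poly a b = z4v_poly a 0 + z4v_poly 0 b" for a b
    by (simp add: z4v_poly_add)
  ultimately show "?J \<subseteq> Idl\<^bsub>type_ring\<^esub> ?G"
    using G' by (smt (verit) mem_Collect_eq subset_iff)
qed

text \<open>Well-definedness on the quotients: congruent components modulo \<open>x^n - 1\<close>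
  give congruent combinations.\<close>

lemma xn1_class_z4v_poly_cong:
  assumes "xn1_class n a = xn1_class n a'" "xn1_class n b = xn1_class n b'"
  shows "xn1_class n (z4v_poly a b) = xn1_class n (z4v_poly a' b')"
proof -
  obtain k l where "a - a' = (monom 1 n - 1) * k" "b - b' = (monom 1 n - 1) * l"
    using assms unfolding xn1_class_eq_iff by (meson dvdE)
  then have "z4v_poly a b - z4v_poly a' b'
      = z4v_poly (monom 1 n - 1) (monom 1 n - 1) * z4v_poly k l"
    by (simp add: z4v_poly_diff z4v_poly_mult)
  \<comment> \<open>By \<open>z4v_poly_diag\<close> the first factor is \<open>x^n - 1\<close> over
    R, which gives the divisibility.\<close>
  then show ?thesis
    unfolding xn1_class_eq_iff by (simp add: z4v_poly_diag hom_distribs)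
qed

section \<open>From codes to ideals of the quotient\<close>

lemma word_poly_code_sum:
  assumes "dim_vec c = dim_vec d"
  shows "word_poly (vR \<cdot>\<^sub>v map_vec of_z4 c + (1 - vR) \<cdot>\<^sub>v map_vec of_z4 d)
    = z4v_poly (word_poly c) (word_poly d)"
  using assms
  by (simp add: word_poly_def z4v_poly_def hom_distribs smult_sum2 smult_monom
      sum.distrib flip: add_monom)

lemma linear_code_dim_vec:
  assumes "linear_code n C" "c \<in> C"
  shows "dim_vec c = n"
proof -
  have "C \<subseteq> carrier_vec n"
    using submodule.axioms(1)[OF assms(1)[unfolded linear_code_def]] subgroup.subset
    by (fastforce simp: module_vec_def)
  then show ?thesis
    using assms(2) by auto
qed

text \<open>Word polynomials may be exchanged for any congruent polynomials in \<open>I1\<close> and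
  \<open>I2\<close>, since the combination depends only on the classes. This links codewords to
  ideals of Z4[x].\<close>

lemma code_ideal_code_sum:
  assumes "linear_code n C1" "linear_code n C2"
    and "code_ideal n C1 = xn1_class n ` I1" "code_ideal n C2 = xn1_class n ` I2"
  shows "code_ideal n (code_sum C1 C2) = xn1_class n ` {z4v_poly a b | a b. a \<in> I1 \<and> b \<in> I2}"
proof -
  \<comment> \<open>All words of both codes have length \<open>n\<close>, so
    \<open>word_poly_code_sum\<close> applies to every pair.\<close>
  have "code_ideal n (code_sum C1 C2)
      = {xn1_class n (z4v_poly (word_poly c) (word_poly d)) | c d. c \<in> C1 \<and> d \<in> C2}"
    using linear_code_dim_vec[OF assms(1)] linear_code_dim_vec[OF assms(2)]
    by (force simp: code_ideal_def code_sum_def word_poly_code_sum)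
  also have "\<dots> = xn1_class n ` {z4v_poly a b | a b. a \<in> I1 \<and> b \<in> I2}" (is "?L = ?R")
  proof (intro equalityI subsetI)
    fix w assume "w \<in> ?L"
    then obtain c d where w: "w = xn1_class n (z4v_poly (word_poly c) (word_poly d))"
      and "c \<in> C1" "d \<in> C2"
      by blast
    then have "xn1_class n (word_poly c) \<in> xn1_class n ` I1"
      "xn1_class n (word_poly d) \<in> xn1_class n ` I2"
      unfolding assms(3,4)[symmetric] code_ideal_def by blast+
    then obtain a b where "a \<in> I1" "b \<in> I2"
      and "xn1_class n (word_poly c) = xn1_class n a" "xn1_class n (word_poly d) = xn1_class n b"
      by blast
    moreover from this(3,4) have "w = xn1_class n (z4v_poly a b)"
      unfolding w by (rule xn1_class_z4v_poly_cong)
    ultimately show "w \<in> ?R"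
      by blast
  next
    fix w assume "w \<in> ?R"
    then obtain a b where w: "w = xn1_class n (z4v_poly a b)" and "a \<in> I1" "b \<in> I2"
      by blast
    then have "xn1_class n a \<in> code_ideal n C1" "xn1_class n b \<in> code_ideal n C2"
      using assms(3,4) by auto
    then obtain c d where "c \<in> C1" "d \<in> C2"
      and "xn1_class n a = xn1_class n (word_poly c)" "xn1_class n b = xn1_class n (word_poly d)"
      unfolding code_ideal_def by blast
    moreover from this(3,4) have "w = xn1_class n (z4v_poly (word_poly c) (word_poly d))"
      unfolding w by (rule xn1_class_z4v_poly_cong)
    ultimately show "w \<in> ?L"
      by blast
  qed
  finally show ?thesis .
qed

theorem theorem3p5:
  fixes n :: nat
    and C :: "z4v vec set" and C1 C2 :: "z4 vec set"
    and p1 q1 r1 p2 q2 r2 :: "z4 poly"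
  assumes "odd n"
    and "cyclic_code n C" and "cyclic_code n C1" and "cyclic_code n C2"
    and "C = code_sum C1 C2"
    and "lead_coeff p1 = 1" and "lead_coeff q1 = 1" and "lead_coeff r1 = 1"
    and "p1 * q1 * r1 = monom 1 n - 1"
    and "code_ideal n C1 = Idl\<^bsub>xn1_ring n\<^esub> {xn1_class n (p1 * q1), xn1_class n (2 * p1)}"
    and "lead_coeff p2 = 1" and "lead_coeff q2 = 1" and "lead_coeff r2 = 1"
    and "p2 * q2 * r2 = monom 1 n - 1"
    and "code_ideal n C2 = Idl\<^bsub>xn1_ring n\<^esub> {xn1_class n (p2 * q2), xn1_class n (2 * p2)}"
  shows "code_ideal n C = Idl\<^bsub>xn1_ring n\<^esub>
    {xn1_class n (smult vR (map_poly of_z4 (p1 * q1))),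
     xn1_class n (smult (2 * vR) (map_poly of_z4 p1)),
     xn1_class n (smult (1 - vR) (map_poly of_z4 (p2 * q2))),
     xn1_class n (smult (2 * (1 - vR)) (map_poly of_z4 p2))}"
proof -
  \<comment> \<open>Each of the four generators has one zero component. Writing the factor 2 as a
    sum lets additivity carry it through the embedding of Z4.\<close>
  have gens: "smult vR (map_poly of_z4 a) = z4v_poly a 0"
    "smult (2 * vR) (map_poly of_z4 a) = z4v_poly (2 * a) 0"
    "smult (1 - vR) (map_poly of_z4 a) = z4v_poly 0 a"
    "smult (2 * (1 - vR)) (map_poly of_z4 a) = z4v_poly 0 (2 * a)" for a
    unfolding z4v_poly_def mult_2 map_of_z4.hom_add smult_add_left smult_add_right by simp_all
  let ?X = "{p1 * q1, 2 * p1}" and ?Y = "{p2 * q2, 2 * p2}"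
  have "code_ideal n C1 = xn1_class n ` (Idl\<^bsub>type_ring\<^esub> ?X)"
    "code_ideal n C2 = xn1_class n ` (Idl\<^bsub>type_ring\<^esub> ?Y)"
    using assms(10,15) by (simp_all flip: genideal_xn1_class)
  then have "code_ideal n C
      = xn1_class n ` {z4v_poly a b | a b. a \<in> Idl\<^bsub>type_ring\<^esub> ?X \<and> b \<in> Idl\<^bsub>type_ring\<^esub> ?Y}"
    using assms(3-5) by (simp add: code_ideal_code_sum cyclic_code_def)
  \<comment> \<open>The product of the two ideals is a generated ideal in R[x], and projecting it
    gives the ideal generated by the classes.\<close>
  also have "\<dots> = Idl\<^bsub>xn1_ring n\<^esub> (xn1_class n ` ((\<lambda>a. z4v_poly a 0) ` ?X \<union> z4v_poly 0 ` ?Y))"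
    by (simp only: genideal_xn1_class genideal_z4v_poly)
  finally show ?thesis
    unfolding gens by (simp add: insert_commute)
qed

end
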